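(* Let $A\in\mathbb{R}^{n\times n}$ and $B\in\mathbb{R}^{n\times s}$ be constant matrices. Let $X(t)$ be the exact solution on $[t_0,T_f]$ of $\dot X(t)=AX(t)+X(t)A^T+BB^T$ with $X(t_0)=0$, and let $X_m(t)$ be the approximate solution obtained at step $m$ (defined in the context). Then for $t\in[t_0,T_f]$ $$\|X(t)-X_m(t)\|\le e^{t\mu_2(A)}\big(\|B\|+\|B_m\|\big)\int_{t_0}^te^{-\tau\mu_2(A)}\,\big\|e^{(t-\tau)A}B-\mathcal{V}_me^{(t-\tau)\mathcal{T}_m}B_m\big\|\,d\tau,$$ where $\mu_2(A)=\lambda_{\max}\big((A+A^T)/2\big)$, $B_m=\mathcal{V}_m^TB$, and $\|\cdot\|$ is the spectral (matrix 2-) norm.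
   Context: $B$ has full rank. The approximate solution at step $m$ is $X_m(t)=\mathcal{V}_mG_m(t)\mathcal{V}_m^T$ with $$G_m(t)=\int_{t_0}^t e^{(t-\tau)\mathcal{T}_m}B_mB_m^Te^{(t-\tau)\mathcal{T}_m^T}\,d\tau,\qquad \mathcal{T}_m=\mathcal{V}_m^TA\mathcal{V}_m,\quad B_m=\mathcal{V}_m^TB,$$ where the columns of $\mathcal{V}_m$ form an orthonormal basis of the block Krylov subspace $\mathrm{range}(B,AB,\dots,A^{m-1}B)$ or, for nonsingular $A$, of the extended block Krylov subspace $\mathrm{range}(A^{-m}B,\dots,A^{-1}B,B,AB,\dots,A^{m-1}B)$. *)

theory Defs
  imports "HOL-Analysis.Analysis"
begin

(* Library multiplication and powers on vectors of vectors act entrywise, so powers of a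
   square matrix have to be formed with the matrix product. *)
primrec matpow :: "real^'n^'n \<Rightarrow> nat \<Rightarrow> real^'n^'n" where
  "matpow A 0 = mat 1"
| "matpow A (Suc k) = A ** matpow A k"

definition matexp :: "real^'n^'n \<Rightarrow> real^'n^'n" where
  "matexp A = (\<Sum>k. (1 / fact k) *\<^sub>R matpow A k)"

(* The norm of the type real^'n^'m is the Frobenius norm; the matrix 2-norm is the
   operator norm with respect to the Euclidean vector norms. *)
definition spectral_norm :: "real^'n^'m \<Rightarrow> real" where
  "spectral_norm M = onorm ((*v) M)"

definition eigenvalue :: "real^'n^'n \<Rightarrow> real \<Rightarrow> bool" where
  "eigenvalue M l \<longleftrightarrow> (\<exists>v. v \<noteq> 0 \<and> M *v v = l *\<^sub>R v)"

(* Only used for symmetric M, where all eigenvalues are real and at least one exists. *)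
definition lambda_max :: "real^'n^'n \<Rightarrow> real" where
  "lambda_max M = Max {l. eigenvalue M l}"

definition mu2 :: "real^'n^'n \<Rightarrow> real" where
  "mu2 A = lambda_max ((1 / 2) *\<^sub>R (A + transpose A))"

definition full_rank :: "real^'s^'n \<Rightarrow> bool" where
  "full_rank B \<longleftrightarrow> rank B = min CARD('n) CARD('s)"

(* range (B, AB, ..., A^(m-1) B): the span of all columns of all the blocks *)
definition block_krylov :: "nat \<Rightarrow> real^'n^'n \<Rightarrow> real^'s^'n \<Rightarrow> (real^'n) set" where
  "block_krylov m A B = span (\<Union>i\<in>{..<m}. columns (matpow A i ** B))"

(* range (A^(-m) B, ..., A^(-1) B, B, AB, ..., A^(m-1) B), meant for invertible A *)
definition extended_block_krylov :: "nat \<Rightarrow> real^'n^'n \<Rightarrow> real^'s^'n \<Rightarrow> (real^'n) set" where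
  "extended_block_krylov m A B =
     span ((\<Union>i\<in>{1..m}. columns (matpow (matrix_inv A) i ** B)) \<union>
           (\<Union>i\<in>{..<m}. columns (matpow A i ** B)))"

definition orthonormal_basis_of :: "real^'k^'n \<Rightarrow> (real^'n) set \<Rightarrow> bool" where
  "orthonormal_basis_of V K \<longleftrightarrow>
     (\<forall>i j. column i V \<bullet> column j V = (if i = j then 1 else 0)) \<and> span (columns V) = K"

(* The dimension of the subspace is CARD('k); it may be smaller than m s (or 2 m s)
   when the blocks are linearly dependent. *)
definition krylov_basis :: "nat \<Rightarrow> real^'n^'n \<Rightarrow> real^'s^'n \<Rightarrow> real^'k^'n \<Rightarrow> bool" where
  "krylov_basis m A B V \<longleftrightarrow>
     orthonormal_basis_of V (block_krylov m A B) \<or>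
     invertible A \<and> orthonormal_basis_of V (extended_block_krylov m A B)"

definition proj_A :: "real^'n^'n \<Rightarrow> real^'k^'n \<Rightarrow> real^'k^'k" where
  "proj_A A V = transpose V ** A ** V"

definition proj_B :: "real^'s^'n \<Rightarrow> real^'k^'n \<Rightarrow> real^'s^'k" where
  "proj_B B V = transpose V ** B"

definition G_approx :: "real \<Rightarrow> real^'n^'n \<Rightarrow> real^'s^'n \<Rightarrow> real^'k^'n \<Rightarrow> real \<Rightarrow> real^'k^'k" where
  "G_approx t0 A B V t =
     integral {t0..t} (\<lambda>\<tau>. matexp ((t - \<tau>) *\<^sub>R proj_A A V) ** proj_B B V **
       transpose (proj_B B V) ** matexp ((t - \<tau>) *\<^sub>R transpose (proj_A A V)))"

definition X_approx :: "real \<Rightarrow> real^'n^'n \<Rightarrow> real^'s^'n \<Rightarrow> real^'k^'n \<Rightarrow> real \<Rightarrow> real^'n^'n" where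
  "X_approx t0 A B V t = V ** G_approx t0 A B V t ** transpose V"

(* Derivatives are one-sided at the two endpoints of the interval. *)
definition lyapunov_solution ::
  "real \<Rightarrow> real \<Rightarrow> real^'n^'n \<Rightarrow> real^'s^'n \<Rightarrow> (real \<Rightarrow> real^'n^'n) \<Rightarrow> bool" where
  "lyapunov_solution t0 Tf A B X \<longleftrightarrow>
     X t0 = 0 \<and>
     (\<forall>t\<in>{t0..Tf}. (X has_vector_derivative
        (A ** X t + X t ** transpose A + B ** transpose B)) (at t within {t0..Tf}))"

end

theory Submission
  imports Defs
begin

text \<open>With \<open>Z \<tau> = exp ((t - \<tau>) A) B\<close> and \<open>W \<tau> = V exp ((t - \<tau>) T) B\<^sub>m\<close>, variation of constants
  gives \<open>X t - X\<^sub>m t = \<integral> (Z Z\<^sup>T - W W\<^sup>T) d\<tau>\<close>, and the integrand factors as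
  \<open>Z (Z - W)\<^sup>T + (Z - W) W\<^sup>T\<close>. The logarithmic norm bound \<open>\<parallel>exp (s A)\<parallel> \<le> exp (s \<mu>)\<close> for \<open>s \<ge> 0\<close> holds
  for every \<open>\<mu>\<close> with \<open>x \<bullet> A x \<le> \<mu> (x \<bullet> x)\<close>; since \<open>V\<close> has orthonormal columns, the compression
  \<open>T = V\<^sup>T A V\<close> satisfies it with the same \<open>\<mu> = \<mu>\<^sub>2(A)\<close>.\<close>

section \<open>Matrix product, transpose and entries as bounded linear operations\<close>

lemma matrix_add_rdistrib:
  fixes A B :: "real^'n^'m" and C :: "real^'p^'n"
  shows "(A + B) ** C = A ** C + B ** C"
  by (simp add: matrix_matrix_mult_def vec_eq_iff sum.distrib algebra_simps)

lemma bounded_bilinear_matrix_mult: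
  "bounded_bilinear ((**) :: real^'n^'m \<Rightarrow> real^'p^'n \<Rightarrow> real^'p^'m)"
  unfolding bilinear_conv_bounded_bilinear[symmetric] bilinear_def
  by (auto intro!: linearI simp: matrix_add_ldistrib matrix_add_rdistrib
      scalar_matrix_assoc[symmetric] matrix_scalar_ac)

interpretation matrix_mult:
  bounded_bilinear "(**) :: real^'n^'m \<Rightarrow> real^'p^'n \<Rightarrow> real^'p^'m"
  by (rule bounded_bilinear_matrix_mult)

lemma bounded_linear_transpose: "bounded_linear (transpose :: real^'n^'m \<Rightarrow> real^'m^'n)"
  unfolding linear_conv_bounded_linear[symmetric]
  by (auto intro!: linearI simp: transpose_scalar) (auto simp: transpose_def vec_eq_iff)

lemma bounded_linear_matrix_vector_left: "bounded_linear (\<lambda>M :: real^'n^'m. M *v v)"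
  unfolding linear_conv_bounded_linear[symmetric]
  by (auto intro!: linearI simp: matrix_vector_mult_add_rdistrib scaleR_matrix_vector_assoc)

lemma bounded_linear_entry: "bounded_linear (\<lambda>M :: real^'n^'m. M $ i $ j)"
  unfolding linear_conv_bounded_linear[symmetric] by (auto intro!: linearI)

text \<open>Serves to differentiate a matrix power series: each entry is a real power series, to
  which termwise differentiation applies.\<close>

lemma has_vector_derivative_entrywise:
  fixes F :: "real \<Rightarrow> real^'n^'m"
  assumes "\<And>i j. ((\<lambda>x. F x $ i $ j) has_real_derivative D $ i $ j) (at x within S)"
  shows "(F has_vector_derivative D) (at x within S)"
  using assms
  unfolding has_vector_derivative_def has_derivative_componentwise_within[of F]
    has_real_derivative_iff_has_vector_derivative
  by (auto simp: Basis_vec_def inner_axis)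

section \<open>The matrix exponential and its derivative\<close>

lemma matpow_commute: "matpow A k ** A = A ** matpow A k"
  by (induction k) (simp_all flip: matrix_mul_assoc)

lemma matpow_scaleR: "matpow (s *\<^sub>R A) k = s ^ k *\<^sub>R matpow A k"
  by (induction k) (simp_all add: scalar_matrix_assoc[symmetric] matrix_scalar_ac)

lemma matpow_transpose: "matpow (transpose A) k = transpose (matpow A k)"
proof (induction k)
  case (Suc k)
  then show ?case using matpow_commute[of A k]
    by (metis matpow.simps(2) matrix_transpose_mul)
qed simp

text \<open>Boundedness of the product supplies a constant \<open>K\<close>; the terms are then
  dominated, up to the factor \<open>norm (mat 1)\<close>, by those of the scalar exponential series
  at \<open>K * norm A\<close>.\<close>

lemma summable_matexp:
  fixes A :: "real^'n^'n"
  shows "summable (\<lambda>k. (1 / fact k) *\<^sub>R matpow A k)"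
proof -
  obtain K where K: "K > 0" "\<And>(M :: real^'n^'n) (N :: real^'n^'n). norm (M ** N) \<le> norm M * norm N * K"
    using matrix_mult.pos_bounded by blast
  have bound: "norm (matpow A k) \<le> norm (mat 1 :: real^'n^'n) * (K * norm A) ^ k" for k
  proof (induction k)
    case (Suc k)
    have "norm (matpow A (Suc k)) \<le> (K * norm A) * norm (matpow A k)"
      using K(2)[of A "matpow A k"] by (simp add: mult_ac)
    also have "\<dots> \<le> (K * norm A) * (norm (mat 1 :: real^'n^'n) * (K * norm A) ^ k)"
      using Suc K(1) by (intro mult_left_mono) auto
    finally show ?case by (simp add: mult_ac)
  qed simp
  have "summable (\<lambda>k. norm (mat 1 :: real^'n^'n) * ((K * norm A) ^ k /\<^sub>R fact k))"
    by (intro summable_mult summable_exp_generic)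
  then show ?thesis
    by (rule summable_comparison_test'[where N=0])
      (use bound in \<open>auto simp: field_simps\<close>)
qed

lemma matexp_0: "matexp (0 :: real^'n^'n) = mat 1"
proof -
  have "matpow (0 :: real^'n^'n) k = (if k = 0 then mat 1 else 0)" for k
    by (cases k) (auto simp: matrix_matrix_mult_def vec_eq_iff)
  then have "matexp (0 :: real^'n^'n) = (\<Sum>k. if k = 0 then mat 1 else 0)"
    unfolding matexp_def by (intro suminf_cong) auto
  also have "\<dots> = mat 1"
    using suminf_finite[of "{0::nat}" "\<lambda>k. if k = 0 then mat 1 else (0 :: real^'n^'n)"] by auto
  finally show ?thesis .
qed

lemma matexp_transpose: "matexp (transpose A) = transpose (matexp A)"
  unfolding matexp_def
  by (simp add: bounded_linear.suminf[OF bounded_linear_transpose summable_matexp]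
      matpow_transpose transpose_scalar)

text \<open>Multiplication by \<open>A\<close> from either side is bounded linear, so it passes
  inside the series, where \<open>A\<close> commutes with each of its powers.\<close>

lemma matexp_commute: "matexp (s *\<^sub>R A) ** A = A ** matexp (s *\<^sub>R A)"
  unfolding matexp_def
    bounded_linear.suminf[OF matrix_mult.bounded_linear_left summable_matexp]
    bounded_linear.suminf[OF matrix_mult.bounded_linear_right summable_matexp]
  by (simp add: matpow_scaleR matpow_commute scalar_matrix_assoc[symmetric] matrix_scalar_ac)

lemma has_vector_derivative_matexp:
  fixes A :: "real^'n^'n"
  shows "((\<lambda>s. matexp (s *\<^sub>R A)) has_vector_derivative A ** matexp (s *\<^sub>R A)) (at s within S)"
proof (rule has_vector_derivative_entrywise)
  fix i j
  define c where "c k = matpow A k $ i $ j / fact k" for k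
  \<comment> \<open>The left factor \<open>M\<close> is kept free: \<open>mat 1\<close> gives the
    entry series of the exponential, \<open>A\<close> that of the claimed derivative.\<close>
  have entry_sums: "(\<lambda>k. (M ** ((1 / fact k) *\<^sub>R matpow (x *\<^sub>R A) k)) $ i $ j) sums
      (M ** matexp (x *\<^sub>R A)) $ i $ j" for M :: "real^'n^'n" and x
    unfolding matexp_def
    by (intro bounded_linear.sums[OF bounded_linear_entry] summable_sums summable_matexp
        bounded_linear.sums[OF matrix_mult.bounded_linear_right])
  have c: "(\<lambda>k. c k * x ^ k) sums (matexp (x *\<^sub>R A) $ i $ j)" for x
    using entry_sums[of "mat 1" x] by (simp add: c_def matpow_scaleR mult_ac)
  \<comment> \<open>The factor \<open>Suc k\<close> produced by differentiation reduces
    \<open>fact (Suc k)\<close> to \<open>fact k\<close>, and the shifted power is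
    \<open>A ** matpow A k\<close>.\<close>
  have "diffs c k = (A ** matpow A k) $ i $ j / fact k" for k
    by (simp add: c_def diffs_def del: of_nat_Suc)
  then have "(\<lambda>k. diffs c k * s ^ k) sums ((A ** matexp (s *\<^sub>R A)) $ i $ j)"
    using entry_sums[of A s]
    by (simp add: matpow_scaleR scalar_matrix_assoc[symmetric] matrix_scalar_ac mult_ac)
  then have "(\<Sum>k. diffs c k * s ^ k) = (A ** matexp (s *\<^sub>R A)) $ i $ j"
    by (simp add: sums_iff)
  with termdiffs_strong_converges_everywhere[of c s] c
  show "((\<lambda>s. matexp (s *\<^sub>R A) $ i $ j) has_real_derivative (A ** matexp (s *\<^sub>R A)) $ i $ j)
      (at s within S)"
    by (auto simp: sums_iff intro: DERIV_subset)
qed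

lemma has_vector_derivative_matexp_backward:
  "((\<lambda>\<tau>. matexp ((t - \<tau>) *\<^sub>R A)) has_vector_derivative - (A ** matexp ((t - \<tau>) *\<^sub>R A)))
    (at \<tau> within S)"
proof -
  have "((\<lambda>\<tau>. t - \<tau>) has_vector_derivative -1) (at \<tau> within S)"
    by (auto intro!: derivative_eq_intros)
  from vector_diff_chain_within[OF this has_vector_derivative_matexp] show ?thesis
    by (simp add: o_def)
qed

lemma continuous_on_matexp_backward: "continuous_on S (\<lambda>\<tau>. matexp ((t - \<tau>) *\<^sub>R A))"
  unfolding continuous_on_eq_continuous_within
  by (rule ballI, rule has_vector_derivative_continuous, rule has_vector_derivative_matexp_backward)

section \<open>Logarithmic norm bound for the exponential\<close>

lemma inner_matrix_vector: "x \<bullet> ((M :: real^'n^'m) *v y) = (transpose M *v x) \<bullet> y"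
  by (simp add: dot_lmul_matrix)

text \<open>Monotonicity of \<open>exp (- 2 * \<mu> * s) * (norm (exp (s A) v))\<^sup>2\<close>.\<close>

lemma norm_matexp_le:
  assumes A: "\<And>x. x \<bullet> (A *v x) \<le> \<mu> * (x \<bullet> x)" and "s \<ge> 0"
  shows "norm (matexp (s *\<^sub>R A) *v v) \<le> exp (s * \<mu>) * norm v"
proof -
  define x where "x s = matexp (s *\<^sub>R A) *v v" for s
  define f where "f s = exp (- 2 * \<mu> * s) * (x s \<bullet> x s)" for s
  have x: "(x has_vector_derivative A *v x s) (at s)" for s
    using bounded_linear.has_vector_derivative[OF bounded_linear_matrix_vector_left has_vector_derivative_matexp]
    by (simp add: x_def[abs_def] matrix_vector_mul_assoc)
  have "((\<lambda>s. x s \<bullet> x s) has_real_derivative 2 * (x s \<bullet> (A *v x s))) (at s)" for s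
    using bounded_bilinear.has_vector_derivative[OF bounded_bilinear_inner x x, of s]
    by (simp add: has_real_derivative_iff_has_vector_derivative inner_commute)
  then have f: "(f has_real_derivative
      2 * exp (- 2 * \<mu> * s) * (x s \<bullet> (A *v x s) - \<mu> * (x s \<bullet> x s))) (at s)" for s
    unfolding f_def[abs_def] by (auto intro!: derivative_eq_intros simp: algebra_simps)
  \<comment> \<open>The derivative of \<open>f\<close> is a positive factor times a difference that
    the hypothesis on \<open>A\<close> makes nonpositive.\<close>
  have "f s \<le> f 0"
    by (rule DERIV_nonpos_imp_nonincreasing[OF \<open>s \<ge> 0\<close>], rule exI, rule conjI, rule f)
      (use A in \<open>simp add: mult_nonneg_nonpos\<close>)
  also have "f 0 = (norm v)\<^sup>2"
    by (simp add: f_def x_def matexp_0 power2_norm_eq_inner)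
  \<comment> \<open>Multiplying by \<open>(exp (s * \<mu>))\<^sup>2\<close> undoes the weight in
    \<open>f\<close>.\<close>
  finally have "(exp (s * \<mu>))\<^sup>2 * f s \<le> (exp (s * \<mu>))\<^sup>2 * (norm v)\<^sup>2"
    by (intro mult_left_mono) auto
  moreover have "(exp (s * \<mu>))\<^sup>2 * f s = (norm (x s))\<^sup>2"
  proof -
    have "(exp (s * \<mu>))\<^sup>2 * exp (- 2 * \<mu> * s) = 1"
      by (simp add: power2_eq_square flip: exp_add)
    then show ?thesis
      by (simp only: f_def power2_norm_eq_inner mult.assoc[symmetric] mult_1_left)
  qed
  ultimately have "(norm (x s))\<^sup>2 \<le> (exp (s * \<mu>) * norm v)\<^sup>2"
    by (simp add: power_mult_distrib)
  then show ?thesis unfolding x_def by (rule power2_le_imp_le) simp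
qed

section \<open>Eigenvalues of symmetric matrices and the meaning of \<open>mu2\<close>\<close>

text \<open>Eigenvectors for distinct eigenvalues are orthogonal, and pairwise orthogonal nonzero
  vectors are independent, hence finitely many. Finiteness is what makes the \<open>Max\<close> in
  \<open>lambda_max\<close> an upper bound of the eigenvalues.\<close>

lemma finite_eigenvalues_symmetric:
  fixes S :: "real^'n^'n"
  assumes sym: "transpose S = S"
  shows "finite {l. eigenvalue S l}"
proof -
  let ?E = "{l. eigenvalue S l}"
  define v where "v l = (SOME v. v \<noteq> 0 \<and> S *v v = l *\<^sub>R v)" for l
  have v: "v l \<noteq> 0 \<and> S *v v l = l *\<^sub>R v l" if "l \<in> ?E" for l
    using that unfolding v_def eigenvalue_def mem_Collect_eq by (rule someI_ex)
  have inj: "inj_on v ?E"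
  proof (rule inj_onI)
    fix k l assume k: "k \<in> ?E" and l: "l \<in> ?E" and "v k = v l"
    then have "k *\<^sub>R v l = l *\<^sub>R v l" using v[OF k] v[OF l] by metis
    then show "k = l" using v[OF l] by simp
  qed
  have "v k \<bullet> v l = 0" if k: "k \<in> ?E" and l: "l \<in> ?E" and "k \<noteq> l" for k l
  proof -
    \<comment> \<open>Both sides are values of \<open>v k \<bullet> (S *v v l)\<close>: one by
      applying \<open>S\<close> to \<open>v l\<close>, the other after moving \<open>S\<close> to
      \<open>v k\<close> by symmetry.\<close>
    have "l * (v k \<bullet> v l) = k * (v k \<bullet> v l)"
      using inner_matrix_vector[of "v k" S "v l", unfolded sym] v[OF k] v[OF l] by simp
    then show ?thesis using \<open>k \<noteq> l\<close> by simp
  qed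
  then have "pairwise orthogonal (v ` ?E)"
    by (auto simp: pairwise_def orthogonal_def)
  moreover have "0 \<notin> v ` ?E" using v by force
  ultimately have "finite (v ` ?E)"
    by (intro independent_imp_finite pairwise_orthogonal_independent)
  then show ?thesis using inj by (simp add: finite_image_iff)
qed

text \<open>A maximiser of the Rayleigh quotient is an eigenvector: the form
  \<open>\<lambda>x. l * (x \<bullet> x) - x \<bullet> (S *v x)\<close> is positive semidefinite and vanishes at it.\<close>

lemma rayleigh_bound:
  fixes S :: "real^'n^'n"
  assumes sym: "transpose S = S"
  obtains l where "eigenvalue S l" "\<And>x. x \<bullet> (S *v x) \<le> l * (x \<bullet> x)"
proof -
  have "sphere (0 :: real^'n) 1 \<noteq> {}" by simp
  moreover have "continuous_on (sphere (0 :: real^'n) 1) (\<lambda>x. x \<bullet> (S *v x))"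
    by (intro continuous_intros linear_continuous_on matrix_vector_mul_bounded_linear)
  ultimately have "\<exists>u\<in>sphere 0 1. \<forall>x\<in>sphere 0 1. x \<bullet> (S *v x) \<le> u \<bullet> (S *v u)"
    by (rule continuous_attains_sup[OF compact_sphere])
  then obtain u where u: "norm u = 1" "\<And>x. norm x = 1 \<Longrightarrow> x \<bullet> (S *v x) \<le> u \<bullet> (S *v u)"
    by auto
  define l where "l = u \<bullet> (S *v u)"
  have max: "x \<bullet> (S *v x) \<le> l * (x \<bullet> x)" for x
  proof (cases "x = 0")
    case False
    \<comment> \<open>The quadratic form is homogeneous of degree two, so maximality on the unit
      sphere is used at the normalised vector.\<close>
    then have "((1 / norm x) *\<^sub>R x) \<bullet> (S *v ((1 / norm x) *\<^sub>R x)) \<le> l"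
      unfolding l_def by (intro u(2)) simp
    with False show ?thesis
      by (simp add: matrix_vector_mult_scaleR field_simps power2_norm_eq_inner flip: power2_eq_square)
  qed simp
  have "S *v u - l *\<^sub>R u = 0"
  proof -
    define y where "y = S *v u - l *\<^sub>R u"
    define c where "c = l * (y \<bullet> y) - y \<bullet> (S *v y)"
    have c: "c \<ge> 0" using max[of y] by (simp add: c_def)
    have uu: "u \<bullet> u = 1" using u(1) by (simp add: power2_norm_eq_inner[symmetric])
    have uSy: "u \<bullet> (S *v y) = (S *v u) \<bullet> y"
      using inner_matrix_vector[of u S y] sym by simp
    \<comment> \<open>Nonnegativity of the semidefinite form at \<open>u + r *\<^sub>R y\<close>:
      its constant term in \<open>r\<close> vanishes by the choice of \<open>l\<close>, its linear
      coefficient is \<open>- 2 * (y \<bullet> y)\<close>, and its quadratic coefficient is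
      \<open>c\<close>.\<close>
    have q: "2 * r * (y \<bullet> y) \<le> r\<^sup>2 * c" for r
    proof -
      have "2 * r * ((S *v u) \<bullet> y - l * (u \<bullet> y)) \<le> r\<^sup>2 * c"
        using max[of "u + r *\<^sub>R y"] uu uSy
        by (simp add: c_def l_def matrix_vector_right_distrib matrix_vector_mult_scaleR
            inner_add_left inner_add_right inner_commute algebra_simps power2_eq_square)
      moreover have "(S *v u) \<bullet> y - l * (u \<bullet> y) = y \<bullet> y"
        by (simp add: y_def algebra_simps)
      ultimately show ?thesis by simp
    qed
    have "y \<bullet> y \<le> 0"
    proof (cases "c = 0")
      case True
      then show ?thesis using q[of 1] by simp
    next
      case False
      with c have "c > 0" by simp
      \<comment> \<open>This \<open>r\<close> minimises
        \<open>r\<^sup>2 * c - 2 * r * (y \<bullet> y)\<close>; the minimum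
        \<open>- (y \<bullet> y)\<^sup>2 / c\<close> can be nonnegative only if \<open>y\<close> is
        zero.\<close>
      then show ?thesis using q[of "(y \<bullet> y) / c"]
        by (auto simp: field_simps power2_eq_square mult_le_0_iff)
    qed
    then show ?thesis
      unfolding y_def[symmetric] by (metis inner_gt_zero_iff not_less)
  qed
  then have "eigenvalue S l" using u(1) unfolding eigenvalue_def by (intro exI[of _ u]) auto
  with max show ?thesis by (rule that[rotated])
qed

text \<open>The quadratic form of \<open>A\<close> is that of its symmetric part, which is bounded
  through some eigenvalue, and that eigenvalue is at most the largest one.\<close>

lemma inner_le_mu2: "x \<bullet> (A *v x) \<le> mu2 A * (x \<bullet> x)"
proof -
  define S where "S = (1 / 2) *\<^sub>R (A + transpose A)"
  have S: "transpose S = S"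
    by (simp add: S_def transpose_def vec_eq_iff)
  obtain l where l: "eigenvalue S l" "x \<bullet> (S *v x) \<le> l * (x \<bullet> x)"
    using rayleigh_bound[OF S] by blast
  have "l \<le> mu2 A"
    using finite_eigenvalues_symmetric[OF S] l(1)
    unfolding mu2_def lambda_max_def S_def[symmetric] by simp
  then have "l * (x \<bullet> x) \<le> mu2 A * (x \<bullet> x)" by (intro mult_right_mono) auto
  moreover have "x \<bullet> (S *v x) = x \<bullet> (A *v x)"
  proof -
    have "S *v x = (1 / 2) *\<^sub>R (A *v x + transpose A *v x)"
      by (simp add: S_def matrix_vector_mult_add_rdistrib flip: scaleR_matrix_vector_assoc)
    then show ?thesis
      using inner_matrix_vector[of x A x] by (simp add: inner_add_right inner_commute)
  qed
  ultimately show ?thesis using l(2) by simp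
qed

section \<open>Variation of constants for the Lyapunov equation\<close>

text \<open>Conjugating \<open>X\<close> by the backward exponential gives a function
  \<open>Y\<close> that runs from \<open>0\<close> at \<open>t0\<close> to \<open>X t\<close> at
  \<open>t\<close>. In its derivative the terms with \<open>A\<close> cancel and only the source
  term remains, so the fundamental theorem of calculus applies.\<close>

lemma has_integral_lyapunov_solution:
  fixes A :: "real^'n^'n" and B :: "real^'s^'n"
  assumes X: "lyapunov_solution t0 Tf A B X" and t: "t \<in> {t0..Tf}"
  shows "((\<lambda>\<tau>. (matexp ((t - \<tau>) *\<^sub>R A) ** B) ** transpose (matexp ((t - \<tau>) *\<^sub>R A) ** B))
    has_integral X t) {t0..t}"
proof -
  define E where "E \<tau> = matexp ((t - \<tau>) *\<^sub>R A)" for \<tau>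
  define Y where "Y \<tau> = (E \<tau> ** X \<tau>) ** transpose (E \<tau>)" for \<tau>
  have comm: "E \<tau> ** A = A ** E \<tau>" for \<tau>
    by (simp add: E_def matexp_commute)
  have "(Y has_vector_derivative (E \<tau> ** B) ** transpose (E \<tau> ** B)) (at \<tau> within {t0..t})"
    if \<tau>: "\<tau> \<in> {t0..t}" for \<tau>
  proof -
    \<comment> \<open>Commutation puts \<open>A\<close> to the right of \<open>E \<tau>\<close>,
      next to \<open>X \<tau>\<close>, where it cancels against the term
      \<open>A ** X \<tau>\<close> of the equation.\<close>
    have dE: "(E has_vector_derivative - (E \<tau> ** A)) (at \<tau> within {t0..t})"
      unfolding comm unfolding E_def by (rule has_vector_derivative_matexp_backward)
    have "(X has_vector_derivative A ** X \<tau> + X \<tau> ** transpose A + B ** transpose B)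
        (at \<tau> within {t0..Tf})"
      using X t \<tau> unfolding lyapunov_solution_def by auto
    then have dX: "(X has_vector_derivative A ** X \<tau> + X \<tau> ** transpose A + B ** transpose B)
        (at \<tau> within {t0..t})"
      by (rule has_vector_derivative_within_subset) (use t in auto)
    have dET: "((\<lambda>\<tau>. transpose (E \<tau>)) has_vector_derivative - (transpose A ** transpose (E \<tau>)))
        (at \<tau> within {t0..t})"
      using bounded_linear.has_vector_derivative[OF bounded_linear_transpose dE]
      by (simp add: linear_neg[OF bounded_linear.linear[OF bounded_linear_transpose]]
          matrix_transpose_mul)
    have "(Y has_vector_derivative
        (E \<tau> ** X \<tau>) ** (- (transpose A ** transpose (E \<tau>))) +
        (E \<tau> ** (A ** X \<tau> + X \<tau> ** transpose A + B ** transpose B) + (- (E \<tau> ** A)) ** X \<tau>)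
          ** transpose (E \<tau>)) (at \<tau> within {t0..t})"
      unfolding Y_def[abs_def]
      by (intro matrix_mult.has_vector_derivative dE dX dET)
    then show ?thesis
      by (simp add: matrix_mult.add_left matrix_mult.add_right matrix_mult.minus_left
          matrix_mult.minus_right matrix_mul_assoc matrix_transpose_mul)
  qed
  then have "((\<lambda>\<tau>. (E \<tau> ** B) ** transpose (E \<tau> ** B)) has_integral Y t - Y t0) {t0..t}"
    using t by (intro fundamental_theorem_of_calculus) auto
  moreover have "Y t = X t" "Y t0 = 0"
    using X by (simp_all add: Y_def E_def matexp_0 lyapunov_solution_def matrix_mult.zero_left
        matrix_mult.zero_right)
  ultimately show ?thesis by (simp add: E_def)
qed

section \<open>Properties of the spectral norm\<close>

lemma norm_matrix_vector_le_spectral: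
  fixes M :: "real^'n^'m"
  shows "norm (M *v x) \<le> spectral_norm M * norm x"
  unfolding spectral_norm_def by (rule onorm[OF matrix_vector_mul_bounded_linear])

lemma spectral_norm_le:
  fixes M :: "real^'n^'m"
  assumes "\<And>x. norm (M *v x) \<le> c * norm x"
  shows "spectral_norm M \<le> c"
  unfolding spectral_norm_def by (rule onorm_le[OF assms])

lemma spectral_norm_nonneg: "spectral_norm (M :: real^'n^'m) \<ge> 0"
  unfolding spectral_norm_def by (rule onorm_pos_le[OF matrix_vector_mul_bounded_linear])

lemma spectral_norm_mult: "spectral_norm (M ** N) \<le> spectral_norm M * spectral_norm N"
  for M :: "real^'n^'m" and N :: "real^'p^'n"
proof (rule spectral_norm_le)
  fix x
  have "norm (M *v (N *v x)) \<le> spectral_norm M * norm (N *v x)"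
    by (rule norm_matrix_vector_le_spectral)
  also have "\<dots> \<le> spectral_norm M * (spectral_norm N * norm x)"
    by (intro mult_left_mono norm_matrix_vector_le_spectral spectral_norm_nonneg)
  finally show "norm ((M ** N) *v x) \<le> spectral_norm M * spectral_norm N * norm x"
    by (simp add: matrix_vector_mul_assoc mult.assoc)
qed

lemma spectral_norm_add: "spectral_norm (M + N) \<le> spectral_norm M + spectral_norm N"
  for M N :: "real^'n^'m"
proof (rule spectral_norm_le)
  fix x
  have "norm ((M + N) *v x) \<le> norm (M *v x) + norm (N *v x)"
    unfolding matrix_vector_mult_add_rdistrib by (rule norm_triangle_ineq)
  also have "\<dots> \<le> spectral_norm M * norm x + spectral_norm N * norm x"
    by (intro add_mono norm_matrix_vector_le_spectral)
  finally show "norm ((M + N) *v x) \<le> (spectral_norm M + spectral_norm N) * norm x"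
    by (simp add: distrib_right)
qed

text \<open>For \<open>y = transpose M *v x\<close>, Cauchy-Schwarz bounds
  \<open>y \<bullet> y = x \<bullet> (M *v y)\<close> by
  \<open>norm x * spectral_norm M * norm y\<close>; dividing by \<open>norm y\<close> gives one
  inequality, and using it for \<open>transpose M\<close> as well gives equality.\<close>

lemma spectral_norm_transpose: "spectral_norm (transpose M) = spectral_norm M"
proof -
  have le: "spectral_norm (transpose M) \<le> spectral_norm M" for M :: "real^'p^'q"
  proof (rule spectral_norm_le)
    fix x
    let ?y = "transpose M *v x"
    have "norm ?y * norm ?y = x \<bullet> (M *v ?y)"
      using inner_matrix_vector[of x M ?y]
      by (simp add: power2_norm_eq_inner flip: power2_eq_square)
    also have "\<dots> \<le> norm x * norm (M *v ?y)" by (rule norm_cauchy_schwarz)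
    also have "\<dots> \<le> norm x * (spectral_norm M * norm ?y)"
      by (intro mult_left_mono norm_matrix_vector_le_spectral) simp
    finally have "norm ?y * norm ?y \<le> (spectral_norm M * norm x) * norm ?y"
      by (simp only: mult_ac)
    then show "norm ?y \<le> spectral_norm M * norm x"
    proof (cases "norm ?y = 0")
      case True
      then show ?thesis using spectral_norm_nonneg[of M] by (simp only: mult_nonneg_nonneg norm_ge_zero)
    next
      case False
      then have "norm ?y > 0" using norm_ge_zero[of ?y] by linarith
      then show ?thesis
        using \<open>norm ?y * norm ?y \<le> (spectral_norm M * norm x) * norm ?y\<close>
        by (rule mult_right_le_imp_le[rotated])
    qed
  qed
  show ?thesis using le[of M] le[of "transpose M"] by simp
qed

text \<open>Subadditivity and homogeneity make it convex, and a real convex function on a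
  finite-dimensional space is continuous. This yields integrability of the right-hand side of the
  error bound.\<close>

lemma continuous_on_spectral_norm: "continuous_on UNIV (spectral_norm :: real^'n^'m \<Rightarrow> real)"
proof (rule convex_on_continuous)
  have scale: "spectral_norm (u *\<^sub>R M) \<le> u * spectral_norm M" if "u \<ge> 0" for u and M :: "real^'n^'m"
    using that norm_matrix_vector_le_spectral[of M]
    by (intro spectral_norm_le)
      (simp add: scaleR_matrix_vector_assoc[symmetric] mult.assoc mult_left_mono)
  show "convex_on UNIV (spectral_norm :: real^'n^'m \<Rightarrow> real)"
    unfolding convex_on_def
    by (auto intro!: order_trans[OF spectral_norm_add] add_mono scale)
qed simp

text \<open>The norm of the matrix type is the Frobenius norm, so the estimate is made after
  applying the integral to a vector, where the Euclidean norm is the right one.\<close>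

lemma spectral_norm_integral_le:
  fixes F :: "real \<Rightarrow> real^'n^'m"
  assumes F: "F integrable_on S" and g: "g integrable_on S"
    and le: "\<And>x. x \<in> S \<Longrightarrow> spectral_norm (F x) \<le> g x"
  shows "spectral_norm (integral S F) \<le> integral S g"
proof (rule spectral_norm_le)
  fix v
  have "norm (integral S F *v v) = norm (integral S (\<lambda>x. F x *v v))"
    using integral_linear[OF F bounded_linear_matrix_vector_left] by (simp add: o_def)
  also have "\<dots> \<le> integral S (\<lambda>x. g x * norm v)"
  proof (rule integral_norm_bound_integral)
    show "(\<lambda>x. F x *v v) integrable_on S"
      using integrable_linear[OF F bounded_linear_matrix_vector_left] by (simp add: o_def)
    show "(\<lambda>x. g x * norm v) integrable_on S"
      using g by (rule integrable_on_mult_left)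
    show "norm (F x *v v) \<le> g x * norm v" if "x \<in> S" for x
      using norm_matrix_vector_le_spectral[of "F x" v] mult_right_mono[OF le[OF that], of "norm v"]
      by simp
  qed
  finally show "norm (integral S F *v v) \<le> integral S g * norm v" by simp
qed

section \<open>Bounds for the integrand and the error estimate\<close>

lemma spectral_norm_gram_diff:
  fixes Z W :: "real^'s^'n"
  shows "spectral_norm (Z ** transpose Z - W ** transpose W)
    \<le> (spectral_norm Z + spectral_norm W) * spectral_norm (Z - W)"
proof -
  have "Z ** transpose Z - W ** transpose W = Z ** transpose (Z - W) + (Z - W) ** transpose W"
    by (simp add: linear_diff[OF bounded_linear.linear[OF bounded_linear_transpose]]
        matrix_mult.diff_left matrix_mult.diff_right)
  also have "spectral_norm \<dots> \<le> spectral_norm Z * spectral_norm (transpose (Z - W))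
      + spectral_norm (Z - W) * spectral_norm (transpose W)"
    by (intro order_trans[OF spectral_norm_add] add_mono spectral_norm_mult)
  finally show ?thesis by (simp add: spectral_norm_transpose algebra_simps)
qed

lemma spectral_norm_matexp_le:
  assumes "\<And>x. x \<bullet> (A *v x) \<le> \<mu> * (x \<bullet> x)" and "s \<ge> 0"
  shows "spectral_norm (matexp (s *\<^sub>R A)) \<le> exp (s * \<mu>)"
  using norm_matexp_le[OF assms] by (rule spectral_norm_le)

lemma orthonormal_columns:
  assumes "orthonormal_basis_of V K"
  shows "transpose V ** V = mat 1"
  using assms
  by (auto simp: orthonormal_basis_of_def matrix_mult_transpose_dot_column mat_def vec_eq_iff)

theorem theorem2p6:
  fixes A :: "real^'n^'n" and B :: "real^'s^'n" and V :: "real^'k^'n"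
    and X :: "real \<Rightarrow> real^'n^'n" and t0 Tf t :: real and m :: nat
  assumes "full_rank B"
    and "lyapunov_solution t0 Tf A B X"
    and "m \<ge> 1"
    and "krylov_basis m A B V"
    and "t \<in> {t0..Tf}"
  shows "spectral_norm (X t - X_approx t0 A B V t)
    \<le> exp (t * mu2 A) * (spectral_norm B + spectral_norm (proj_B B V)) *
      integral {t0..t} (\<lambda>\<tau>. exp (- \<tau> * mu2 A) *
        spectral_norm (matexp ((t - \<tau>) *\<^sub>R A) ** B
          - V ** matexp ((t - \<tau>) *\<^sub>R proj_A A V) ** proj_B B V))"
proof -
  define \<mu> where "\<mu> = mu2 A"
  define T where "T = proj_A A V"
  define Bm where "Bm = proj_B B V"
  define Z where "Z \<tau> = matexp ((t - \<tau>) *\<^sub>R A) ** B" for \<tau>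
  define W where "W \<tau> = V ** matexp ((t - \<tau>) *\<^sub>R T) ** Bm" for \<tau>
  \<comment> \<open>The ordinary and the extended Krylov space are treated together, with
    \<open>K\<close> standing for either.\<close>
  obtain K where "orthonormal_basis_of V K"
    using assms(4) unfolding krylov_basis_def by blast
  then have VV: "transpose V ** V = mat 1" by (rule orthonormal_columns)
  have norm_V: "spectral_norm V \<le> 1"
  proof (rule spectral_norm_le)
    fix x
    have "(V *v x) \<bullet> (V *v x) = x \<bullet> x"
      by (simp only: inner_matrix_vector matrix_vector_mul_assoc VV matrix_vector_mul_lid)
    then show "norm (V *v x) \<le> 1 * norm x" by (simp add: norm_eq_sqrt_inner)
  qed
  have A: "x \<bullet> (A *v x) \<le> \<mu> * (x \<bullet> x)" for x
    unfolding \<mu>_def by (rule inner_le_mu2)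
  have T: "y \<bullet> (T *v y) \<le> \<mu> * (y \<bullet> y)" for y
  proof -
    have "y \<bullet> (T *v y) = (V *v y) \<bullet> (A *v (V *v y))"
      by (simp only: T_def proj_A_def inner_matrix_vector[of y "transpose V"]
          matrix_vector_mul_assoc[symmetric] transpose_transpose)
    also have "\<dots> \<le> \<mu> * ((V *v y) \<bullet> (V *v y))" by (rule A)
    also have "(V *v y) \<bullet> (V *v y) = y \<bullet> y"
      by (simp only: inner_matrix_vector matrix_vector_mul_assoc VV matrix_vector_mul_lid)
    finally show ?thesis .
  qed
  have cont: "continuous_on {t0..t} Z" "continuous_on {t0..t} W"
    unfolding Z_def[abs_def] W_def[abs_def]
    by (intro matrix_mult.continuous_on continuous_on_const continuous_on_matexp_backward)+
  note cont_transpose = bounded_linear.continuous_on[OF bounded_linear_transpose]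
  have int_W: "(\<lambda>\<tau>. W \<tau> ** transpose (W \<tau>)) integrable_on {t0..t}"
    by (intro integrable_continuous_real matrix_mult.continuous_on cont cont_transpose)
  \<comment> \<open>The constant outer factors \<open>V\<close> and \<open>transpose V\<close> move
    inside the integral; since the exponential commutes with transposition, the integrand becomes a
    Gram product.\<close>
  have "X_approx t0 A B V t = integral {t0..t} (\<lambda>\<tau>. W \<tau> ** transpose (W \<tau>))"
  proof -
    define G where "G \<tau> = matexp ((t - \<tau>) *\<^sub>R T) ** Bm ** transpose Bm **
      matexp ((t - \<tau>) *\<^sub>R transpose T)" for \<tau>
    have G: "G integrable_on {t0..t}"
      unfolding G_def[abs_def]
      by (intro integrable_continuous_real matrix_mult.continuous_on continuous_on_const
          continuous_on_matexp_backward)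
    have lin: "bounded_linear (\<lambda>M. V ** M ** transpose V)"
      by (rule bounded_linear_compose[OF matrix_mult.bounded_linear_left matrix_mult.bounded_linear_right])
    have "integral {t0..t} (\<lambda>\<tau>. V ** G \<tau> ** transpose V) = X_approx t0 A B V t"
      using integral_linear[OF G lin]
      by (simp add: o_def X_approx_def G_approx_def G_def[abs_def] T_def Bm_def)
    moreover have "V ** G \<tau> ** transpose V = W \<tau> ** transpose (W \<tau>)" for \<tau>
      by (simp add: G_def W_def matrix_transpose_mul matrix_mul_assoc matexp_transpose
          flip: transpose_scalar)
    ultimately show ?thesis by simp
  qed
  moreover have "((\<lambda>\<tau>. Z \<tau> ** transpose (Z \<tau>)) has_integral X t) {t0..t}"
    unfolding Z_def using assms(2,5) by (rule has_integral_lyapunov_solution)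
  ultimately have diff:
    "((\<lambda>\<tau>. Z \<tau> ** transpose (Z \<tau>) - W \<tau> ** transpose (W \<tau>)) has_integral
      X t - X_approx t0 A B V t) {t0..t}"
    using int_W by (auto intro!: has_integral_diff integrable_integral)
  \<comment> \<open>The majorant is \<open>c * g \<tau>\<close>: of
    \<open>exp ((t - \<tau>) * \<mu>)\<close>, the factor free of \<open>\<tau>\<close> goes into
    \<open>c\<close> and leaves the integral.\<close>
  define g where "g \<tau> = exp (- \<tau> * \<mu>) * spectral_norm (Z \<tau> - W \<tau>)" for \<tau>
  define c where "c = exp (t * \<mu>) * (spectral_norm B + spectral_norm Bm)"
  have "g integrable_on {t0..t}"
    unfolding g_def[abs_def]
    by (intro integrable_continuous_real continuous_intros cont
        continuous_on_compose2[OF continuous_on_spectral_norm]) auto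
  then have int_g: "(\<lambda>\<tau>. c * g \<tau>) integrable_on {t0..t}"
    by (rule integrable_on_mult_right)
  have "spectral_norm (Z \<tau> ** transpose (Z \<tau>) - W \<tau> ** transpose (W \<tau>)) \<le> c * g \<tau>"
    if "\<tau> \<in> {t0..t}" for \<tau>
  proof -
    let ?e = "exp ((t - \<tau>) * \<mu>)"
    have s: "t - \<tau> \<ge> 0" using that by simp
    have "spectral_norm (Z \<tau>) \<le> spectral_norm (matexp ((t - \<tau>) *\<^sub>R A)) * spectral_norm B"
      unfolding Z_def by (rule spectral_norm_mult)
    also have "\<dots> \<le> ?e * spectral_norm B"
      by (intro mult_right_mono spectral_norm_matexp_le A s spectral_norm_nonneg)
    finally have Z: "spectral_norm (Z \<tau>) \<le> ?e * spectral_norm B" .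
    have "spectral_norm (W \<tau>)
        \<le> spectral_norm V * spectral_norm (matexp ((t - \<tau>) *\<^sub>R T)) * spectral_norm Bm"
      unfolding W_def
      by (intro order_trans[OF spectral_norm_mult] mult_right_mono spectral_norm_mult
          spectral_norm_nonneg)
    \<comment> \<open>The factor \<open>?e\<close> is the same as for \<open>Z \<tau>\<close>,
      because \<open>T\<close> obeys the quadratic form bound with the same
      \<open>\<mu>\<close>.\<close>
    also have "\<dots> \<le> 1 * ?e * spectral_norm Bm"
      by (intro mult_right_mono mult_mono spectral_norm_matexp_le T s norm_V spectral_norm_nonneg)
        simp
    finally have "spectral_norm (Z \<tau>) + spectral_norm (W \<tau>)
        \<le> ?e * (spectral_norm B + spectral_norm Bm)"
      using Z by (simp add: distrib_left)
    then have "(spectral_norm (Z \<tau>) + spectral_norm (W \<tau>)) * spectral_norm (Z \<tau> - W \<tau>)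
        \<le> ?e * (spectral_norm B + spectral_norm Bm) * spectral_norm (Z \<tau> - W \<tau>)"
      by (intro mult_right_mono spectral_norm_nonneg)
    also have "?e = exp (t * \<mu>) * exp (- \<tau> * \<mu>)"
      by (simp add: left_diff_distrib flip: exp_add)
    finally show ?thesis
      using spectral_norm_gram_diff[of "Z \<tau>" "W \<tau>"] by (simp add: c_def g_def mult_ac)
  qed
  then have "spectral_norm (X t - X_approx t0 A B V t) \<le> integral {t0..t} (\<lambda>\<tau>. c * g \<tau>)"
    using spectral_norm_integral_le[OF has_integral_integrable[OF diff] int_g]
    by (simp add: integral_unique[OF diff])
  also have "\<dots> = c * integral {t0..t} g" by simp
  finally show ?thesis
    unfolding c_def g_def[abs_def] Z_def W_def \<mu>_def T_def Bm_def .
qed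

end
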